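(* Let $n\ge 2$, let $P\subset\mathbb{R}^d$ be an $(n-1)$-dimensional simplex and let $c\in\mathbb{R}^d$ be a generic (i.e. edge-generic) objective function for $P$. Then the max-slope pivot rule polytope $\Pi(P,c)$ is combinatorially isomorphic to the $(n-2)$-dimensional associahedron $\mathrm{Asso}_{n-2}$; that is, the poset of nonempty faces of $\Pi(P,c)$ ordered by inclusion is isomorphic to the poset $\mathrm{Asso}_{n-2}$.
   Context: Let $P\subset\mathbb{R}^d$ be a convex polytope with vertex set $V(P)$ and edge set $E(P)$. A vector $c\in\mathbb{R}^d$ is edge-generic for $P$ if $\langle c,u\rangle\ne\langle c,v\rangle$ for all edges $uv\in E(P)$. Then $c$ has a unique maximizer $v_{\mathrm{opt}}\in V(P)$ over $P$. A $c$-arborescence of $(P,c)$ is a map $\mathcal{A}:V(P)\setminus\{v_{\mathrm{opt}}\}\to V(P)$ such that for every $v\neq v_{\mathrm{opt}}$, $\mathcal{A}(v)$ is adjacent to $v$ and $\langle c,\mathcal{A}(v)\rangle>\langle c,v\rangle$. Put $$\psi(\mathcal{A})=\sum_{v\ne v_{\mathrm{opt}}}\frac{\mathcal{A}(v)-v}{\langle c,\mathcal{A}(v)-v\rangle}.$$ The max-slope pivot rule polytope of $(P,c)$ is $\Pi(P,c)=\mathrm{conv}\{\psi(\mathcal{A}):\mathcal{A}\text{ a }c\text{-arborescence of }(P,c)\}$. A bracket is a set $[i,j]=\{i,i+1,\dots,j\}$ with $1\le i<j\le n$. A bracketing of $[n]=\{1,\dots,n\}$ is a set $\mathcal{B}$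 of brackets containing $[1,n]$ such that any two members of $\mathcal{B}$ are either nested or disjoint. The associahedron $\mathrm{Asso}_{n-2}$ is the set of all bracketings of $[n]$ partially ordered by reverse inclusion (so $\{[1,n]\}$ is the unique maximal element). *)

theory Defs
  imports "HOL-Analysis.Analysis"
begin

definition polytope_vertices :: "'a::euclidean_space set \<Rightarrow> 'a set" where
  "polytope_vertices P = {v. v extreme_point_of P}"

text \<open>A one-dimensional face which is a closed segment has two distinct endpoints, and these are
  extreme points of \<open>P\<close>; so \<open>adjacent P\<close> only relates distinct vertices.\<close>
definition adjacent :: "'a::euclidean_space set \<Rightarrow> 'a \<Rightarrow> 'a \<Rightarrow> bool" where
  "adjacent P u v \<longleftrightarrow> closed_segment u v edge_of P"

definition edge_generic :: "'a::euclidean_space set \<Rightarrow> 'a \<Rightarrow> bool" where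
  "edge_generic P c \<longleftrightarrow> (\<forall>u v. adjacent P u v \<longrightarrow> c \<bullet> u \<noteq> c \<bullet> v)"

text \<open>Meaningful only when the maximizing vertex is unique, in particular for a nonempty polytope
  \<open>P\<close> with \<open>edge_generic P c\<close>.\<close>
definition v_opt :: "'a::euclidean_space set \<Rightarrow> 'a \<Rightarrow> 'a" where
  "v_opt P c = (THE v. v \<in> polytope_vertices P \<and> (\<forall>x\<in>P. c \<bullet> x \<le> c \<bullet> v))"

definition arborescences :: "'a::euclidean_space set \<Rightarrow> 'a \<Rightarrow> ('a \<Rightarrow> 'a) set" where
  "arborescences P c =
     {A \<in> (polytope_vertices P - {v_opt P c}) \<rightarrow>\<^sub>E polytope_vertices P.
        \<forall>v \<in> polytope_vertices P - {v_opt P c}. adjacent P v (A v) \<and> c \<bullet> A v > c \<bullet> v}"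

definition arb_point :: "'a::euclidean_space set \<Rightarrow> 'a \<Rightarrow> ('a \<Rightarrow> 'a) \<Rightarrow> 'a" where
  "arb_point P c A =
     (\<Sum>v \<in> polytope_vertices P - {v_opt P c}. (A v - v) /\<^sub>R (c \<bullet> (A v - v)))"

definition max_slope_polytope :: "'a::euclidean_space set \<Rightarrow> 'a \<Rightarrow> 'a set" where
  "max_slope_polytope P c = convex hull (arb_point P c ` arborescences P c)"

definition nonempty_faces :: "'a::euclidean_space set \<Rightarrow> 'a set set" where
  "nonempty_faces Q = {F. F face_of Q \<and> F \<noteq> {}}"

definition brackets :: "nat \<Rightarrow> nat set set" where
  "brackets n = {{i..j} | i j. 1 \<le> i \<and> i < j \<and> j \<le> n}"

text \<open>The elements of the associahedron of dimension \<open>n - 2\<close>, indexed by \<open>n\<close>; its order is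
  reverse inclusion.\<close>
definition bracketings :: "nat \<Rightarrow> nat set set set" where
  "bracketings n =
     {B. B \<subseteq> brackets n \<and> {1..n} \<in> B \<and>
         (\<forall>I\<in>B. \<forall>J\<in>B. I \<subseteq> J \<or> J \<subseteq> I \<or> I \<inter> J = {})}"

definition poset_isomorphic ::
  "'a set \<Rightarrow> ('a \<Rightarrow> 'a \<Rightarrow> bool) \<Rightarrow> 'b set \<Rightarrow> ('b \<Rightarrow> 'b \<Rightarrow> bool) \<Rightarrow> bool" where
  "poset_isomorphic X le Y le' \<longleftrightarrow>
     (\<exists>f. bij_betw f X Y \<and> (\<forall>x\<in>X. \<forall>y\<in>X. le x y \<longleftrightarrow> le' (f x) (f y)))"

end

theory Submission
  imports Defs
begin

text \<open>
  Sort the vertices \<open>v\<^sub>1, \<dots>, v\<^sub>n\<close> of the simplex by their objective value. All pairs of vertices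
  are adjacent, so an arborescence is an independent choice of \<open>A(i) > i\<close> for each \<open>i < n\<close>, and the
  polytope is a Minkowski sum of simplices. Its face in direction \<open>w\<close> is therefore given by the
  sets of those \<open>j > i\<close> maximizing the slope from \<open>i\<close> to \<open>j\<close> of the points
  \<open>(\<langle>c, v\<^sub>i\<rangle>, \<langle>w, v\<^sub>i\<rangle>)\<close>. Let \<open>m\<^sub>i\<close> be the maximal slope. The maximizing \<open>j\<close> are exactly those
  with \<open>m\<^sub>k \<ge> m\<^sub>i\<close> for \<open>i < k < j\<close> and \<open>m\<^sub>j \<le> m\<^sub>i\<close>, so the objective values have no influence beyond
  the comparisons between the \<open>m\<^sub>i\<close>. The components of the superlevel sets of \<open>m\<close>, with \<open>k\<close> standing
  for the gap between \<open>k\<close> and \<open>k + 1\<close>, form a bracketing, which determines the maximizing sets and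
  is determined by them in an order-reversing way. Every bracketing \<open>B\<close> arises: take \<open>m\<^sub>k\<close> to be
  the number of brackets containing \<open>k\<close> and \<open>k + 1\<close>; every \<open>m\<close> is a sequence of maximal slopes.
\<close>

section \<open>Bracketings from level sets\<close>

text \<open>The conditions \<open>1 < a\<close> and \<open>b < n\<close> amount to the convention \<open>m 0 = m n = -\<infinity>\<close>.\<close>
definition level_brackets :: "nat \<Rightarrow> (nat \<Rightarrow> real) \<Rightarrow> nat set set" where
  "level_brackets n m = {{a..b} | a b. 1 \<le> a \<and> a < b \<and> b \<le> n \<and>
     (\<forall>k\<in>{a..<b}. (1 < a \<longrightarrow> m (a - 1) < m k) \<and> (b < n \<longrightarrow> m b < m k))}"

text \<open>The maximizing sets of the overview, formed for an arbitrary sequence \<open>m\<close>.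
  The guard \<open>j < n\<close> again amounts to \<open>m n = -infinity\<close>.\<close>

definition reach :: "nat \<Rightarrow> (nat \<Rightarrow> real) \<Rightarrow> nat \<Rightarrow> nat set" where
  "reach n m i = {j. i < j \<and> j \<le> n \<and> (\<forall>k\<in>{i<..<j}. m i \<le> m k) \<and> (j < n \<longrightarrow> m j \<le> m i)}"

text \<open>Relation through which level brackets and maximizing sets determine each other: each
  family consists of what is compatible with the whole other family (\<open>mem_reach_iff\<close>,
  \<open>mem_level_brackets_iff\<close>). For \<open>j = n\<close> the second implication is vacuous
  on brackets, since none contains \<open>Suc n\<close>.\<close>

definition compatible :: "nat set \<Rightarrow> nat \<Rightarrow> nat \<Rightarrow> bool" where
  "compatible J i j \<longleftrightarrow> (i \<in> J \<and> Suc i \<in> J \<longrightarrow> j \<in> J) \<and> (j \<in> J \<and> Suc j \<in> J \<longrightarrow> i \<in> J)"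

lemma atLeastAtMost_mem_level_brackets:
  assumes "a < b"
  shows "{a..b} \<in> level_brackets n m \<longleftrightarrow> 1 \<le> a \<and> b \<le> n \<and>
     (\<forall>k\<in>{a..<b}. (1 < a \<longrightarrow> m (a - 1) < m k) \<and> (b < n \<longrightarrow> m b < m k))"
  using assms unfolding level_brackets_def by (auto simp: Icc_eq_Icc)

lemma level_brackets_subset: "level_brackets n m \<subseteq> brackets n"
  unfolding level_brackets_def brackets_def by blast

text \<open>Values at \<open>0\<close> and from \<open>n\<close> on are never read. This matters
  because the slopes realizing a bracketing are prescribed only on \<open>{1..<n}\<close>.\<close>

lemma level_brackets_cong:
  assumes "\<And>i. i \<in> {1..<n} \<Longrightarrow> m i = m' i"
  shows "level_brackets n m = level_brackets n m'"
proof -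
  have "J \<in> level_brackets n m'" if J: "J \<in> level_brackets n m"
    and eq: "\<And>i. i \<in> {1..<n} \<Longrightarrow> m i = m' i" for J and m m' :: "nat \<Rightarrow> real"
  proof -
    from J obtain a b where ab: "J = {a..b}" "a < b"
      using level_brackets_def by auto
    with J have *: "1 \<le> a" "b \<le> n"
      "\<And>k. a \<le> k \<Longrightarrow> k < b \<Longrightarrow> (1 < a \<longrightarrow> m (a - 1) < m k) \<and> (b < n \<longrightarrow> m b < m k)"
      by (auto simp: atLeastAtMost_mem_level_brackets)
    have "(1 < a \<longrightarrow> m' (a - 1) < m' k) \<and> (b < n \<longrightarrow> m' b < m' k)" if "a \<le> k" "k < b" for k
    proof -
      have "m k = m' k" using that *(1,2) by (intro eq) auto
      moreover have "m (a - 1) = m' (a - 1)" if "1 < a"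
        using that *(2) ab(2) by (intro eq) auto
      moreover have "m b = m' b" if "b < n" using that *(1) ab(2) by (intro eq) auto
      ultimately show ?thesis using *(3)[OF that] by auto
    qed
    with * ab show ?thesis by (auto simp: atLeastAtMost_mem_level_brackets)
  qed
  from this[of _ m m'] this[of _ m' m] assms show ?thesis by auto
qed

lemma level_brackets_bracketing:
  assumes "n \<ge> 2"
  shows "level_brackets n m \<in> bracketings n"
proof -
  have top: "{1..n} \<in> level_brackets n m"
    using assms by (simp add: atLeastAtMost_mem_level_brackets)
  \<comment> \<open>For crossing brackets, gap \<open>b\<close> bounds the first and lies inside the
    second, while gap \<open>a' - 1\<close> lies inside the first and bounds the second. Each value
    would be smaller than the other.\<close>
  have no_cross: False
    if 1: "{a..b} \<in> level_brackets n m" and 2: "{a'..b'} \<in> level_brackets n m"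
      and ord: "a < a'" "a' \<le> b" "b < b'" for a b a' b'
  proof -
    have "m b < m (a' - 1)"
      using 1 2 ord by (auto simp: atLeastAtMost_mem_level_brackets)
    moreover have "m (a' - 1) < m b"
      using 1 2 ord by (auto simp: atLeastAtMost_mem_level_brackets)
    ultimately show False by simp
  qed
  have "I \<subseteq> J \<or> J \<subseteq> I \<or> I \<inter> J = {}"
    if I: "I \<in> level_brackets n m" and J: "J \<in> level_brackets n m" for I J
  proof -
    obtain a b where ab: "I = {a..b}" "a < b" using I by (auto simp: level_brackets_def)
    obtain a' b' where ab': "J = {a'..b'}" "a' < b'" using J by (auto simp: level_brackets_def)
    have "\<not> (a < a' \<and> a' \<le> b \<and> b < b')" "\<not> (a' < a \<and> a \<le> b' \<and> b' < b)"
      using no_cross I J ab ab' by blast+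
    then show ?thesis using ab ab' by (auto simp: Icc_eq_Icc)
  qed
  with top level_brackets_subset show ?thesis unfolding bracketings_def by blast
qed

text \<open>The bracket is the component around gap \<open>i\<close> of the superlevel set of
  \<open>t\<close>: its bounding gaps have value at most \<open>t\<close>, hence below every value
  inside.\<close>

lemma level_component:
  assumes i: "1 \<le> i" "i < n" and t: "t < m i"
  obtains a b where "{a..b} \<in> level_brackets n m" "a \<le> i" "i < b" "\<And>k. a \<le> k \<Longrightarrow> k < b \<Longrightarrow> t < m k"
proof -
  \<comment> \<open>The alternative \<open>l = n\<close> is a sentinel that makes the search to the
    right end.\<close>
  define b where "b = (LEAST l. i < l \<and> (l = n \<or> m l \<le> t))"
  have b: "i < b" "b = n \<or> m b \<le> t"
    using LeastI[of "\<lambda>l. i < l \<and> (l = n \<or> m l \<le> t)" n] i unfolding b_def by auto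
  have bl: "b \<le> n" unfolding b_def using i by (intro Least_le) auto
  have bmin: "t < m k" if "i < k" "k < b" for k
    using not_less_Least[of k "\<lambda>l. i < l \<and> (l = n \<or> m l \<le> t)"] that unfolding b_def by auto
  define a where "a = (LEAST a. 1 \<le> a \<and> a \<le> i \<and> (\<forall>k. a \<le> k \<and> k \<le> i \<longrightarrow> t < m k))"
  have ex: "1 \<le> i \<and> i \<le> i \<and> (\<forall>k. i \<le> k \<and> k \<le> i \<longrightarrow> t < m k)" using i t by auto
  have a: "1 \<le> a" "a \<le> i" "\<And>k. a \<le> k \<Longrightarrow> k \<le> i \<Longrightarrow> t < m k"
    using LeastI[of "\<lambda>a. 1 \<le> a \<and> a \<le> i \<and> (\<forall>k. a \<le> k \<and> k \<le> i \<longrightarrow> t < m k)", OF ex]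
    unfolding a_def[symmetric] by auto
  have all: "t < m k" if "a \<le> k" "k < b" for k using a(3) bmin that by (meson not_le)
  \<comment> \<open>Otherwise the run of values above \<open>t\<close> could be prolonged by gap
    \<open>a - 1\<close>, against the minimality of \<open>a\<close>.\<close>
  have "m (a - 1) \<le> t" if "1 < a"
  proof (rule ccontr)
    assume "\<not> m (a - 1) \<le> t"
    then have "\<forall>k. a - 1 \<le> k \<and> k \<le> i \<longrightarrow> t < m k"
      using a(3) by (metis Suc_leI le_neq_implies_less not_le One_nat_def Suc_pred that less_trans zero_less_one)
    moreover have "1 \<le> a - 1" "a - 1 \<le> i" using that a(2) by auto
    ultimately have "\<not> a - 1 < a"
      using not_less_Least[of "a - 1" "\<lambda>a. 1 \<le> a \<and> a \<le> i \<and> (\<forall>k. a \<le> k \<and> k \<le> i \<longrightarrow> t < m k)"]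
      unfolding a_def[symmetric] by blast
    with that show False by simp
  qed
  then have "{a..b} \<in> level_brackets n m"
    using a(1,2) b bl all
    by (subst atLeastAtMost_mem_level_brackets) (auto intro: le_less_trans)
  then show ?thesis using that a(2) b(1) all by blast
qed

text \<open>A level bracket containing gap \<open>i\<close> but ending before \<open>j\<close> would
  have a right bounding gap of value below \<open>m i\<close>; one containing gap \<open>j\<close>
  but starting after \<open>i\<close> would force \<open>m i < m j\<close>. Conversely, a violated
  condition of \<open>reach\<close> yields an incompatible bracket: the component of level
  \<open>m k\<close> around gap \<open>i\<close>, or of level \<open>m i\<close> around gap
  \<open>j\<close>.\<close>

lemma mem_reach_iff:
  assumes "1 \<le> i" "i < j" "j \<le> n"
  shows "j \<in> reach n m i \<longleftrightarrow> (\<forall>J \<in> level_brackets n m. compatible J i j)"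
proof
  assume j: "j \<in> reach n m i"
  show "\<forall>J \<in> level_brackets n m. compatible J i j"
  proof
    fix J assume J: "J \<in> level_brackets n m"
    then obtain a b where ab: "J = {a..b}" "a < b" by (auto simp: level_brackets_def)
    have 1: "1 \<le> a" "b \<le> n"
      "\<And>k. a \<le> k \<Longrightarrow> k < b \<Longrightarrow> (1 < a \<longrightarrow> m (a - 1) < m k) \<and> (b < n \<longrightarrow> m b < m k)"
      using J ab by (auto simp: atLeastAtMost_mem_level_brackets)
    have "j \<le> b" if "a \<le> i" "Suc i \<le> b"
    proof (rule ccontr)
      assume "\<not> j \<le> b"
      then have "m b < m i" "m i \<le> m b" using 1(3)[of i] that j assms by (auto simp: reach_def)
      then show False by simp
    qed
    moreover have "a \<le> i" if "a \<le> j" "Suc j \<le> b"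
    proof (rule ccontr)
      assume "\<not> a \<le> i"
      then have "m (a - 1) < m j" using 1(3)[of j] that assms by auto
      moreover have "m i \<le> m (a - 1)"
      proof (cases "a - 1 = i")
        case False
        then have "a - 1 \<in> {i<..<j}" using \<open>\<not> a \<le> i\<close> that by auto
        then show ?thesis using j by (auto simp: reach_def)
      qed simp
      moreover have "m j \<le> m i" using j that 1(2) by (auto simp: reach_def)
      ultimately show False by simp
    qed
    ultimately show "compatible J i j" using ab assms by (auto simp: compatible_def)
  qed
next
  assume c: "\<forall>J \<in> level_brackets n m. compatible J i j"
  have "m i \<le> m k" if k: "i < k" "k < j" for k
  proof (rule ccontr)
    assume "\<not> m i \<le> m k"
    then obtain a b where "{a..b} \<in> level_brackets n m" "a \<le> i" "i < b"
      "\<And>l. a \<le> l \<Longrightarrow> l < b \<Longrightarrow> m k < m l"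
      using level_component[of i n "m k" m] assms by (auto simp: not_le)
    moreover from this have "b \<le> k" using k by (meson less_irrefl less_imp_le not_le le_less_trans)
    ultimately show False using c k by (force simp: compatible_def)
  qed
  moreover have "m j \<le> m i" if jn: "j < n"
  proof (rule ccontr)
    assume "\<not> m j \<le> m i"
    then obtain a b where "{a..b} \<in> level_brackets n m" "a \<le> j" "j < b"
      "\<And>l. a \<le> l \<Longrightarrow> l < b \<Longrightarrow> m i < m l"
      using level_component[of j n "m i" m] assms jn by (auto simp: not_le)
    moreover from this have "i < a" using assms by (meson less_irrefl not_le less_trans)
    ultimately show False using c assms by (force simp: compatible_def)
  qed
  ultimately show "j \<in> reach n m i" using assms by (auto simp: reach_def)
qed

text \<open>For the converse, a bracket violating the level condition at one of its ends yields a
  pair \<open>(i, j)\<close> with \<open>j\<close> in \<open>reach n m i\<close> that is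
  incompatible with it.\<close>

lemma mem_level_brackets_iff:
  assumes "J \<in> brackets n"
  shows "J \<in> level_brackets n m \<longleftrightarrow> (\<forall>i\<in>{1..<n}. \<forall>j\<in>reach n m i. compatible J i j)"
proof
  assume "J \<in> level_brackets n m"
  then show "\<forall>i\<in>{1..<n}. \<forall>j\<in>reach n m i. compatible J i j"
    using mem_reach_iff[of _ _ n m] unfolding reach_def
    by (metis (no_types, lifting) atLeastLessThan_iff mem_Collect_eq)
next
  assume c: "\<forall>i\<in>{1..<n}. \<forall>j\<in>reach n m i. compatible J i j"
  obtain a b where ab: "J = {a..b}" "1 \<le> a" "a < b" "b \<le> n" using assms by (auto simp: brackets_def)
  have left: "m (a - 1) < m k" if k: "a \<le> k" "k < b" and a1: "1 < a" for k
  proof (rule ccontr)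
    assume "\<not> m (a - 1) < m k"
    then have ex: "a \<le> k \<and> m k \<le> m (a - 1)" using k by auto
    \<comment> \<open>The first gap from \<open>a\<close> on that does not exceed
      \<open>m (a - 1)\<close> is reached from \<open>a - 1\<close>, a point outside
      \<open>J\<close>, while gap \<open>l\<close> lies inside \<open>J\<close>.\<close>
    define l where "l = (LEAST l. a \<le> l \<and> m l \<le> m (a - 1))"
    have l: "a \<le> l" "m l \<le> m (a - 1)" "l \<le> k"
      using LeastI[of "\<lambda>l. a \<le> l \<and> m l \<le> m (a - 1)", OF ex]
        Least_le[of "\<lambda>l. a \<le> l \<and> m l \<le> m (a - 1)", OF ex] unfolding l_def[symmetric] by auto
    have "m (a - 1) < m k'" if "a - 1 < k'" "k' < l" for k'
      using not_less_Least[of k' "\<lambda>l. a \<le> l \<and> m l \<le> m (a - 1)"] that unfolding l_def[symmetric] by auto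
    then have "l \<in> reach n m (a - 1)"
      using l k ab a1 unfolding reach_def by (auto intro: less_imp_le)
    moreover have "a - 1 \<in> {1..<n}" using a1 ab by auto
    ultimately have "compatible J (a - 1) l" using c by blast
    then show False using ab l k a1 by (auto simp: compatible_def)
  qed
  have right: "m b < m k" if k: "a \<le> k" "k < b" and bn: "b < n" for k
  proof (rule ccontr)
    assume "\<not> m b < m k"
    then have ex: "k < b \<and> m k \<le> m b" using k by auto
    \<comment> \<open>By choosing the last such gap, all values strictly between \<open>l\<close>
      and \<open>b\<close> exceed \<open>m b\<close>, hence \<open>m l\<close>, and nothing up to
      \<open>b\<close> blocks \<open>reach\<close> from \<open>l\<close>.\<close>
    define l where "l = (GREATEST l. l < b \<and> m l \<le> m b)"
    have l: "l < b" "m l \<le> m b"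
      using GreatestI_nat[of "\<lambda>l. l < b \<and> m l \<le> m b" k b] ex unfolding l_def[symmetric] by auto
    have kl: "k \<le> l"
      using Greatest_le_nat[of "\<lambda>l. l < b \<and> m l \<le> m b" k b] ex unfolding l_def[symmetric] by auto
    have gt: "m b < m k'" if "l < k'" "k' < b" for k'
      using Greatest_le_nat[of "\<lambda>l. l < b \<and> m l \<le> m b" k' b] that unfolding l_def[symmetric]
      by (meson less_imp_le_nat not_le)
    \<comment> \<open>The first admissible stop beyond \<open>b\<close> is reached from
      \<open>l\<close> and lies outside \<open>J\<close>, although gap \<open>l\<close> lies
      inside.\<close>
    define j where "j = (LEAST j. b < j \<and> (j = n \<or> m j \<le> m l))"
    have ex': "b < n \<and> (n = n \<or> m n \<le> m l)" using bn by auto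
    have j: "b < j" "j = n \<or> m j \<le> m l" "j \<le> n"
      using LeastI[of "\<lambda>j. b < j \<and> (j = n \<or> m j \<le> m l)", OF ex']
        Least_le[of "\<lambda>j. b < j \<and> (j = n \<or> m j \<le> m l)", OF ex'] unfolding j_def[symmetric] by auto
    have "m l \<le> m k'" if "b < k'" "k' < j" for k'
      using not_less_Least[of k' "\<lambda>j. b < j \<and> (j = n \<or> m j \<le> m l)"] that unfolding j_def[symmetric] by auto
    moreover have "m l \<le> m k'" if "l < k'" "k' \<le> b" for k'
      using gt[of k'] l that by (cases "k' = b") auto
    ultimately have "m l \<le> m k'" if "l < k'" "k' < j" for k' using that by (meson not_le)
    then have "j \<in> reach n m l" using j l by (auto simp: reach_def)
    then have "compatible J l j" using c k kl l bn ab by auto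
    then show False using ab j k kl l by (auto simp: compatible_def)
  qed
  show "J \<in> level_brackets n m" using left right ab by (auto simp: atLeastAtMost_mem_level_brackets)
qed

text \<open>Each family is cut out by compatibility with the other, so more brackets leave fewer
  maximizers and conversely. This is the source of the reversed order on bracketings.\<close>

lemma level_brackets_subset_iff:
  "level_brackets n m' \<subseteq> level_brackets n m \<longleftrightarrow> (\<forall>i\<in>{1..<n}. reach n m i \<subseteq> reach n m' i)"
proof
  assume s: "level_brackets n m' \<subseteq> level_brackets n m"
  show "\<forall>i\<in>{1..<n}. reach n m i \<subseteq> reach n m' i"
  proof (intro ballI subsetI)
    fix i j assume "i \<in> {1..<n}" "j \<in> reach n m i"
    moreover from this have "i < j" "j \<le> n" by (auto simp: reach_def)
    ultimately show "j \<in> reach n m' i" using s mem_reach_iff[of i j n] by auto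
  qed
next
  assume "\<forall>i\<in>{1..<n}. reach n m i \<subseteq> reach n m' i"
  then show "level_brackets n m' \<subseteq> level_brackets n m"
    using mem_level_brackets_iff[of _ n] level_brackets_subset by (meson subsetD subsetI)
qed

section \<open>Realizing every bracketing by a sequence\<close>

definition depth :: "nat set set \<Rightarrow> nat \<Rightarrow> real" where
  "depth B k = card {J \<in> B. k \<in> J \<and> Suc k \<in> J}"

text \<open>Crossing the boundary of a member of \<open>B\<close> from inside loses that member and
  gains none, by laminarity; so members are level brackets. Conversely, a level bracket is bounded
  by gaps of smaller depth, which produces a member of \<open>B\<close> starting at its left end and
  one stopping at its right end; since these are nested, one of them is the bracket itself.\<close>

lemma level_brackets_depth:
  assumes "B \<in> bracketings n"
  shows "level_brackets n (depth B) = B"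
proof -
  have B: "B \<subseteq> brackets n" "{1..n} \<in> B"
    and lam: "\<And>I J. I \<in> B \<Longrightarrow> J \<in> B \<Longrightarrow> I \<subseteq> J \<or> J \<subseteq> I \<or> I \<inter> J = {}"
    using assms by (auto simp: bracketings_def)
  have Bf: "J \<subseteq> {1..n}" if "J \<in> B" for J using B(1) that by (auto simp: brackets_def)
  have fin: "finite B" using Bf by (meson finite_Pow_iff finite_atLeastAtMost finite_subset PowI subsetI)
  have sub: "B \<subseteq> level_brackets n (depth B)"
  proof
    fix I assume I: "I \<in> B"
    obtain a b where ab: "I = {a..b}" "1 \<le> a" "a < b" "b \<le> n" using B(1) I by (auto simp: brackets_def)
    \<comment> \<open>The hypothesis on \<open>l\<close> says that gap \<open>l\<close> straddles an
      end of \<open>I\<close>; it covers both \<open>l = a - 1\<close> and \<open>l = b\<close>. A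
      member of \<open>B\<close> over such a gap contains \<open>I\<close>, and \<open>I\<close>
      itself is counted only at \<open>k\<close>.\<close>
    have less: "depth B l < depth B k"
      if k: "a \<le> k" "k < b" and l: "l \<in> I \<longleftrightarrow> Suc l \<notin> I" for k l
    proof -
      have "{J \<in> B. l \<in> J \<and> Suc l \<in> J} \<subseteq> {J \<in> B. k \<in> J \<and> Suc k \<in> J}"
      proof (clarsimp)
        fix J assume J: "J \<in> B" "l \<in> J" "Suc l \<in> J"
        then have "I \<subseteq> J" using lam[OF I J(1)] l by auto
        then show "k \<in> J \<and> Suc k \<in> J" using k ab by auto
      qed
      moreover have "I \<in> {J \<in> B. k \<in> J \<and> Suc k \<in> J}" "I \<notin> {J \<in> B. l \<in> J \<and> Suc l \<in> J}"
        using I k ab l by auto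
      ultimately have "{J \<in> B. l \<in> J \<and> Suc l \<in> J} \<subset> {J \<in> B. k \<in> J \<and> Suc k \<in> J}" by blast
      then show ?thesis unfolding depth_def using fin by (simp add: psubset_card_mono)
    qed
    show "I \<in> level_brackets n (depth B)"
      unfolding ab(1) atLeastAtMost_mem_level_brackets[OF ab(3)]
      using ab by (auto intro!: less)
  qed
  moreover have "level_brackets n (depth B) \<subseteq> B"
  proof
    fix I assume I: "I \<in> level_brackets n (depth B)"
    then obtain a b where ab: "I = {a..b}" "a < b" by (auto simp: level_brackets_def)
    have 1: "1 \<le> a" "b \<le> n"
      "\<And>k. a \<le> k \<Longrightarrow> k < b \<Longrightarrow> (1 < a \<longrightarrow> depth B (a - 1) < depth B k) \<and> (b < n \<longrightarrow> depth B b < depth B k)"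
      using I ab by (auto simp: atLeastAtMost_mem_level_brackets)
    \<comment> \<open>At a gap of minimal depth, every member of \<open>B\<close> over it must cover
      all of \<open>{a..b}\<close>: otherwise one of its bounding gaps would lie inside
      \<open>{a..b}\<close> with still smaller depth.\<close>
    obtain k where k: "k \<in> {a..<b}" "\<And>l. l \<in> {a..<b} \<Longrightarrow> depth B k \<le> depth B l"
      using ex_min_if_finite[of "depth B ` {a..<b}"] ab by (auto simp: not_less)
    have over: "{a..b} \<subseteq> J" if J: "J \<in> B" "k \<in> J" "Suc k \<in> J" for J
    proof -
      obtain c d where cd: "J = {c..d}" "1 \<le> c" "c < d" "d \<le> n" using B(1) J by (auto simp: brackets_def)
      then have *: "\<And>k. c \<le> k \<Longrightarrow> k < d \<Longrightarrow> (1 < c \<longrightarrow> depth B (c - 1) < depth B k) \<and> (d < n \<longrightarrow> depth B d < depth B k)"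
        using sub J by (auto simp: atLeastAtMost_mem_level_brackets)
      have kcd: "c \<le> k" "k < d" using J cd by auto
      have "c \<le> a"
      proof (rule ccontr)
        assume "\<not> c \<le> a"
        then have "c - 1 \<in> {a..<b}" "1 < c" using kcd k(1) 1(1) by auto
        then show False using *[OF kcd] k(2)[of "c - 1"] by auto
      qed
      moreover have "b \<le> d"
      proof (rule ccontr)
        assume "\<not> b \<le> d"
        then have "d \<in> {a..<b}" "d < n" using kcd k(1) 1(2) by auto
        then show False using *[OF kcd] k(2)[of d] by auto
      qed
      ultimately show ?thesis using cd by auto
    qed
    have ex: "\<exists>J\<in>B. k \<in> J \<and> Suc k \<in> J \<and> \<not> (l \<in> J \<and> Suc l \<in> J)" if "depth B l < depth B k" for l
    proof (rule ccontr)
      assume "\<not> ?thesis"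
      then have "{J \<in> B. k \<in> J \<and> Suc k \<in> J} \<subseteq> {J \<in> B. l \<in> J \<and> Suc l \<in> J}" by auto
      then have "depth B k \<le> depth B l" unfolding depth_def using fin by (simp add: card_mono)
      with that show False by simp
    qed
    \<comment> \<open>Gap \<open>a - 1\<close> is less deep than \<open>k\<close>, so some member
      over \<open>k\<close> misses it and must start exactly at \<open>a\<close>. At the boundary
      \<open>a = 1\<close> the member \<open>{1..n}\<close> does the same.\<close>
    have "\<exists>d. {a..d} \<in> B \<and> b \<le> d"
    proof (cases "a = 1")
      case True then show ?thesis using B(2) 1 by auto
    next
      case False
      then obtain J where J: "J \<in> B" "k \<in> J" "Suc k \<in> J" "\<not> (a - 1 \<in> J \<and> Suc (a - 1) \<in> J)"
        using ex[of "a - 1"] 1 k(1) by auto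
      obtain c d where cd: "J = {c..d}" "c < d" using B(1) J by (auto simp: brackets_def)
      show ?thesis using over[OF J(1-3)] J False 1 ab unfolding cd by (intro exI[of _ d]) (cases "c = a"; auto)
    qed
    then obtain d where d: "{a..d} \<in> B" "b \<le> d" by blast
    have "\<exists>c. {c..b} \<in> B \<and> c \<le> a"
    proof (cases "b = n")
      case True then show ?thesis using B(2) 1 by auto
    next
      case False
      then obtain J where J: "J \<in> B" "k \<in> J" "Suc k \<in> J" "\<not> (b \<in> J \<and> Suc b \<in> J)"
        using ex[of b] 1 k(1) by auto
      obtain c d where cd: "J = {c..d}" "c < d" using B(1) J by (auto simp: brackets_def)
      show ?thesis using over[OF J(1-3)] J False 1 ab unfolding cd by (intro exI[of _ c]) (cases "d = b"; auto)
    qed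
    then obtain c where c: "{c..b} \<in> B" "c \<le> a" by blast
    have "a \<in> {a..d} \<inter> {c..b}" using c d ab by auto
    then have "{a..d} \<subseteq> {c..b} \<or> {c..b} \<subseteq> {a..d}" using lam[OF d(1) c(1)] by blast
    then have "d = b \<or> c = a" using c d ab by auto
    then show "I \<in> B" using c d ab by auto
  qed
  ultimately show ?thesis by blast
qed

text \<open>The isomorphism sends \<open>f w\<close> to \<open>g w\<close>. By antisymmetry,
  \<open>f w = f w'\<close> holds exactly when \<open>g w = g w'\<close>, which gives
  well-definedness and injectivity at once.\<close>

lemma poset_isomorphic_range:
  assumes "X = range f" "Y = range g" "\<And>w w'. f w \<subseteq> f w' \<longleftrightarrow> g w' \<subseteq> g w"
  shows "poset_isomorphic X (\<lambda>F G. F \<subseteq> G) Y (\<lambda>B C. C \<subseteq> B)"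
proof -
  define w where "w x = (SOME w. f w = x)" for x
  have w: "f (w x) = x" if "x \<in> X" for x
    using that assms(1) unfolding w_def by (metis (mono_tags, lifting) rangeE someI)
  have ord: "x \<subseteq> y \<longleftrightarrow> g (w y) \<subseteq> g (w x)" if "x \<in> X" "y \<in> X" for x y
    using assms(3)[of "w x" "w y"] w that by auto
  have "inj_on (\<lambda>x. g (w x)) X"
    using ord by (intro inj_onI) (metis subset_antisym order_refl)
  moreover have "(\<lambda>x. g (w x)) ` X = Y"
  proof -
    have "g u \<in> (\<lambda>x. g (w x)) ` X" for u
    proof -
      have "f (w (f u)) = f u" using w assms(1) by auto
      then have "g (w (f u)) = g u" using assms(3) by (metis subset_antisym order_refl)
      then show ?thesis using assms(1) by (metis imageI rangeI)
    qed
    then show ?thesis using assms(2) by auto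
  qed
  ultimately show ?thesis unfolding poset_isomorphic_def
    using ord by (intro exI[of _ "\<lambda>x. g (w x)"]) (auto simp: bij_betw_def)
qed

section \<open>Maximal slopes\<close>

definition slope :: "(nat \<Rightarrow> real) \<Rightarrow> (nat \<Rightarrow> real) \<Rightarrow> nat \<Rightarrow> nat \<Rightarrow> real" where
  "slope h y i j = (y j - y i) / (h j - h i)"

definition max_slope :: "nat \<Rightarrow> (nat \<Rightarrow> real) \<Rightarrow> (nat \<Rightarrow> real) \<Rightarrow> nat \<Rightarrow> real" where
  "max_slope n h y i = Max (slope h y i ` {i<..n})"

text \<open>Shearing by \<open>s\<close> turns comparisons of slopes with \<open>s\<close> into
  comparisons of the heights \<open>y - s * h\<close>, one function serving all starting
  points.\<close>

lemma slope_iff: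
  assumes "h i < h j"
  shows "slope h y i j \<le> s \<longleftrightarrow> y j - s * h j \<le> y i - s * h i"
    and "s \<le> slope h y i j \<longleftrightarrow> y i - s * h i \<le> y j - s * h j"
    and "slope h y i j = s \<longleftrightarrow> y j - s * h j = y i - s * h i"
proof -
  have "0 < h j - h i" using assms by simp
  then show "slope h y i j \<le> s \<longleftrightarrow> y j - s * h j \<le> y i - s * h i"
    and "s \<le> slope h y i j \<longleftrightarrow> y i - s * h i \<le> y j - s * h j"
    unfolding slope_def by (auto simp: pos_divide_le_eq pos_le_divide_eq algebra_simps)
  then show "slope h y i j = s \<longleftrightarrow> y j - s * h j = y i - s * h i" by auto
qed

context
  fixes n :: nat and h :: "nat \<Rightarrow> real"
  assumes h: "strict_mono_on {1..n} h"
begin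

lemma max_slope_iff:
  assumes i: "i \<in> {1..<n}"
  shows "max_slope n h y i \<le> s \<longleftrightarrow> (\<forall>j\<in>{i<..n}. y j - s * h j \<le> y i - s * h i)"
    and "s \<le> max_slope n h y i \<longleftrightarrow> (\<exists>j\<in>{i<..n}. y i - s * h i \<le> y j - s * h j)"
proof -
  have ij: "h i < h j" if "j \<in> {i<..n}" for j
    using i that by (intro strict_mono_onD[OF h]) auto
  have ne: "{i<..n} \<noteq> {}" using i by auto
  show "max_slope n h y i \<le> s \<longleftrightarrow> (\<forall>j\<in>{i<..n}. y j - s * h j \<le> y i - s * h i)"
    unfolding max_slope_def using ne slope_iff(1)[of h i, OF ij] by (subst Max_le_iff) auto
  show "s \<le> max_slope n h y i \<longleftrightarrow> (\<exists>j\<in>{i<..n}. y i - s * h i \<le> y j - s * h j)"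
    unfolding max_slope_def using ne slope_iff(2)[of h i, OF ij] by (subst Max_ge_iff) auto
qed

text \<open>After shearing by the maximal slope \<open>s\<close> at \<open>i\<close>, no later point
  is higher than \<open>i\<close>, and the maximizers are the points level with \<open>i\<close>.
  Moreover the maximal slope at \<open>k\<close> is at least \<open>s\<close> iff some later point
  is at least as high as \<open>k\<close>, and at most \<open>s\<close> iff no later point is
  higher.\<close>

lemma argmax_slope_eq_reach:
  assumes i: "i \<in> {1..<n}"
  shows "{j\<in>{i<..n}. slope h y i j = max_slope n h y i} = reach n (max_slope n h y) i"
proof -
  define s where "s = max_slope n h y i"
  define D where "D k = y k - s * h k" for k
  have le: "max_slope n h y k \<le> s \<longleftrightarrow> (\<forall>j\<in>{k<..n}. D j \<le> D k)"
    and ge: "s \<le> max_slope n h y k \<longleftrightarrow> (\<exists>j\<in>{k<..n}. D k \<le> D j)" if "k \<in> {1..<n}" for k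
    unfolding D_def using max_slope_iff[OF that] by auto
  have top: "D j \<le> D i" if "j \<in> {i<..n}" for j using le[OF i] that by (simp add: s_def)
  have eq: "slope h y i j = s \<longleftrightarrow> D j = D i" if "j \<in> {i<..n}" for j
    unfolding D_def using i that by (intro slope_iff strict_mono_onD[OF h]) auto
  have "slope h y i j = s \<longleftrightarrow> j \<in> reach n (max_slope n h y) i" if j: "j \<in> {i<..n}" for j
    unfolding eq[OF j]
  proof
    assume Dj: "D j = D i"
    have "s \<le> max_slope n h y k" if "k \<in> {i<..<j}" for k
      using that i j top[of k] Dj by (subst ge) (auto intro!: bexI[of _ j])
    moreover have "max_slope n h y j \<le> s" if "j < n"
      using that i j top Dj by (subst le) auto
    ultimately show "j \<in> reach n (max_slope n h y) i" using j by (auto simp: reach_def s_def)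
  next
    assume r: "j \<in> reach n (max_slope n h y) i"
    \<comment> \<open>The last point level with \<open>i\<close>. If \<open>l < j\<close>, the slope
      condition at \<open>l\<close> would give a later point as high; if \<open>j < l\<close>, the
      one at \<open>j\<close> forces \<open>j\<close> to be as high as \<open>l\<close>.\<close>
    define l where "l = (GREATEST l. l \<in> {i<..n} \<and> D l = D i)"
    obtain l0 where "l0 \<in> {i<..n}" "D i \<le> D l0" using ge[OF i] by (auto simp: s_def)
    then have l0: "l0 \<in> {i<..n} \<and> D l0 = D i" using top by force
    have l: "l \<in> {i<..n}" "D l = D i"
      using GreatestI_nat[of "\<lambda>l. l \<in> {i<..n} \<and> D l = D i", OF l0, of n] unfolding l_def[symmetric] by auto
    have last: "k \<le> l" if "k \<in> {i<..n}" "D k = D i" for k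
      using Greatest_le_nat[of "\<lambda>l. l \<in> {i<..n} \<and> D l = D i" k n] that unfolding l_def[symmetric] by auto
    consider "l < j" | "l = j" | "j < l" by linarith
    then show "D j = D i"
    proof cases
      case 1
      then have "s \<le> max_slope n h y l" using r l by (auto simp: reach_def s_def)
      moreover have "l \<in> {1..<n}" using 1 l j by auto
      ultimately obtain k where "k \<in> {l<..n}" "D l \<le> D k" using ge by auto
      then show ?thesis using last[of k] top[of k] l by auto
    next
      case 3
      then have "j \<in> {1..<n}" "max_slope n h y j \<le> s" using r l j by (auto simp: reach_def s_def)
      moreover have "l \<in> {j<..n}" using 3 l by auto
      ultimately have "D l \<le> D j" using le by blast
      then show ?thesis using top[OF j] l by auto
    qed (use l in simp)
  qed
  then show ?thesis by (auto simp: s_def reach_def)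
qed

text \<open>Heights are chosen from right to left: the maximal slope at \<open>i\<close> depends
  only on the heights from \<open>i\<close> on, so a new height leaves the slopes already arranged
  unchanged.\<close>

lemma exists_max_slope: "\<exists>y. \<forall>i\<in>{1..<n}. max_slope n h y i = m i"
proof -
  \<comment> \<open>With truncated subtraction, \<open>d = 0\<close> imposes nothing and
    \<open>d = n\<close> covers all indices.\<close>
  have "\<exists>y. \<forall>i\<in>{1..<n}. n - d \<le> i \<longrightarrow> max_slope n h y i = m i" for d
  proof (induction d)
    case (Suc d)
    then obtain y where y: "\<And>i. i \<in> {1..<n} \<Longrightarrow> n - d \<le> i \<Longrightarrow> max_slope n h y i = m i" by blast
    show ?case
    proof (cases "Suc d < n")
      case False
      then show ?thesis using y by (intro exI[of _ y]) auto
    next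
      case True
      define i where "i = n - Suc d"
      have i: "i \<in> {1..<n}" using True by (auto simp: i_def)
      \<comment> \<open>The least height for which all later points lie on or below the line of
        slope \<open>m i\<close> through point \<open>i\<close>.\<close>
      define z where "z = Max ((\<lambda>j. y j - m i * (h j - h i)) ` {i<..n})"
      define y' where "y' = y(i := z)"
      have ne: "{i<..n} \<noteq> {}" using i by auto
      have "max_slope n h y' k = m k" if "k \<in> {1..<n}" "n - Suc d \<le> k" for k
      proof (cases "k = i")
        case True
        have "y j - m i * (h j - h i) \<le> z" if "j \<in> {i<..n}" for j
          unfolding z_def using that by (intro Max_ge) auto
        then have "max_slope n h y' i \<le> m i"
          unfolding max_slope_iff(1)[OF i] by (auto simp: y'_def algebra_simps)
        moreover have "z \<in> (\<lambda>j. y j - m i * (h j - h i)) ` {i<..n}"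
          unfolding z_def using ne by (intro Max_in) auto
        then obtain j where "j \<in> {i<..n}" "z = y j - m i * (h j - h i)" by blast
        then have "m i \<le> max_slope n h y' i"
          unfolding max_slope_iff(2)[OF i]
          by (intro bexI[of _ j]) (auto simp: y'_def algebra_simps)
        ultimately show ?thesis using True by simp
      next
        case False
        then have k: "i < k" "n - d \<le> k" using that by (auto simp: i_def)
        then have "slope h y' k ` {k<..n} = slope h y k ` {k<..n}"
          by (intro image_cong) (auto simp: slope_def y'_def)
        then show ?thesis using y[OF that(1) k(2)] by (simp add: max_slope_def)
      qed
      then show ?thesis by blast
    qed
  qed auto
  from this[of n] show ?thesis by auto
qed

end

section \<open>Faces of Minkowski sums of finitely generated polytopes\<close>

locale selection_sum =
  fixes I :: "'i set" and J :: "'i \<Rightarrow> 'j set" and g :: "'i \<Rightarrow> 'j \<Rightarrow> 'a::euclidean_space"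
  assumes finI: "finite I" and finJ: "\<And>i. i \<in> I \<Longrightarrow> finite (J i)" and neJ: "\<And>i. i \<in> I \<Longrightarrow> J i \<noteq> {}"
begin

definition point :: "('i \<Rightarrow> 'j) \<Rightarrow> 'a" where
  "point a = (\<Sum>i\<in>I. g i (a i))"

definition sum_polytope :: "'a set" where
  "sum_polytope = convex hull (point ` PiE I J)"

text \<open>The support function of the \<open>i\<close>-th summand; its sum over \<open>I\<close>
  is the support function of \<open>sum_polytope\<close>.\<close>

definition best :: "'a \<Rightarrow> 'i \<Rightarrow> real" where
  "best w i = Max ((\<lambda>j. w \<bullet> g i j) ` J i)"

definition argmax :: "'a \<Rightarrow> 'i \<Rightarrow> 'j set" where
  "argmax w i = {j \<in> J i. w \<bullet> g i j = best w i}"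

definition face :: "'a \<Rightarrow> 'a set" where
  "face w = sum_polytope \<inter> {x. w \<bullet> x = sum (best w) I}"

lemma best_ge: "i \<in> I \<Longrightarrow> j \<in> J i \<Longrightarrow> w \<bullet> g i j \<le> best w i"
  unfolding best_def using finJ by (intro Max_ge) auto

lemma argmax_nonempty: "i \<in> I \<Longrightarrow> argmax w i \<noteq> {}"
proof -
  assume "i \<in> I"
  then have "best w i \<in> (\<lambda>j. w \<bullet> g i j) ` J i"
    unfolding best_def using finJ neJ by (intro Max_in) auto
  then show ?thesis by (auto simp: argmax_def)
qed

lemma inner_point: "w \<bullet> point a = (\<Sum>i\<in>I. w \<bullet> g i (a i))"
  by (simp add: point_def inner_sum_right)

lemma finite_points: "finite (point ` PiE I J)"
  using finI finJ by (simp add: finite_PiE)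

lemma inner_le: "x \<in> sum_polytope \<Longrightarrow> w \<bullet> x \<le> sum (best w) I"
proof -
  have "point ` PiE I J \<subseteq> {x. w \<bullet> x \<le> sum (best w) I}"
    by (auto simp: inner_point intro!: sum_mono best_ge)
  then have "sum_polytope \<subseteq> {x. w \<bullet> x \<le> sum (best w) I}"
    unfolding sum_polytope_def by (intro hull_minimal convex_halfspace_le)
  then show "x \<in> sum_polytope \<Longrightarrow> w \<bullet> x \<le> sum (best w) I" by auto
qed

text \<open>A sum of terms, each at most \<open>best w i\<close>, attains the sum of these bounds
  only if every term attains its own.\<close>

lemma point_mem_face:
  assumes a: "a \<in> PiE I J"
  shows "point a \<in> face w \<longleftrightarrow> (\<forall>i\<in>I. a i \<in> argmax w i)"
proof -
  have "point a \<in> sum_polytope" unfolding sum_polytope_def using a by (intro hull_inc) auto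
  moreover have "w \<bullet> point a = sum (best w) I \<longleftrightarrow> (\<forall>i\<in>I. a i \<in> argmax w i)"
  proof
    assume "w \<bullet> point a = sum (best w) I"
    then have "(\<Sum>i\<in>I. w \<bullet> g i (a i)) = sum (best w) I" by (simp add: inner_point)
    then have "w \<bullet> g i (a i) = best w i" if "i \<in> I" for i
      using a that finI by (intro sum_mono_inv[where f = "\<lambda>i. w \<bullet> g i (a i)" and I = I]) (auto intro: best_ge)
    then show "\<forall>i\<in>I. a i \<in> argmax w i" using a by (auto simp: argmax_def)
  next
    assume "\<forall>i\<in>I. a i \<in> argmax w i"
    then show "w \<bullet> point a = sum (best w) I"
      by (auto simp: inner_point argmax_def intro!: sum.cong)
  qed
  ultimately show ?thesis by (simp add: face_def)
qed

text \<open>Every maximizer is visible in the face, so the sets \<open>argmax w i\<close> can be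
  recovered from it: any selection of maximizers may be altered at one index.\<close>

lemma exists_point_mem_face:
  assumes "i \<in> I" "j \<in> argmax w i"
  shows "\<exists>a\<in>PiE I J. a i = j \<and> point a \<in> face w"
proof -
  obtain b where b: "b \<in> PiE I (argmax w)"
    using argmax_nonempty[of _ w] PiE_eq_empty_iff[of I "argmax w"] by blast
  define a where "a = b(i := j)"
  have am: "a k \<in> argmax w k" if "k \<in> I" for k
    using that assms(2) PiE_mem[OF b] by (auto simp: a_def)
  moreover have "a k = undefined" if "k \<notin> I" for k
    using that assms(1) b by (auto simp: a_def PiE_def extensional_def)
  ultimately have "a \<in> PiE I J" by (auto simp: argmax_def)
  then show ?thesis using am point_mem_face by (intro bexI[of _ a]) (auto simp: a_def)
qed

lemma face_nonempty: "face w \<noteq> {}"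
proof -
  obtain a where a: "a \<in> PiE I (argmax w)"
    using argmax_nonempty[of _ w] PiE_eq_empty_iff[of I "argmax w"] by blast
  then have "a \<in> PiE I J" by (auto simp: argmax_def PiE_def Pi_def)
  then have "point a \<in> face w" using a by (auto simp: point_mem_face)
  then show ?thesis by blast
qed

lemma face_face_of: "face w face_of sum_polytope"
  unfolding face_def using inner_le
  by (intro face_of_Int_supporting_hyperplane_le) (auto simp: sum_polytope_def)

text \<open>Faces of a polytope are exposed, and nonemptiness forces the level of the supporting
  hyperplane to be the support value. The whole polytope arises from \<open>w = 0\<close>.\<close>

lemma nonempty_faces_eq: "nonempty_faces sum_polytope = range face"
proof -
  have "F \<in> range face" if F: "F face_of sum_polytope" "F \<noteq> {}" for F
  proof -
    have "polyhedron sum_polytope"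
      unfolding sum_polytope_def using finite_points by (intro polytope_imp_polyhedron) (auto simp: polytope_def)
    then have "F exposed_face_of sum_polytope" using F exposed_face_of_polyhedron by blast
    then obtain w b where w: "sum_polytope \<subseteq> {x. w \<bullet> x \<le> b}" "F = sum_polytope \<inter> {x. w \<bullet> x = b}"
      by (auto simp: exposed_face_of_def)
    obtain x where "x \<in> F" using F by blast
    then have "b \<le> sum (best w) I" using w inner_le[of x w] by auto
    moreover obtain y where "y \<in> face w" using face_nonempty by blast
    then have "sum (best w) I \<le> b" using w by (auto simp: face_def)
    ultimately have "F = face w" using w by (simp add: face_def)
    then show ?thesis by blast
  qed
  then show ?thesis using face_face_of face_nonempty by (auto simp: nonempty_faces_def)
qed

lemma face_subset_iff: "face w \<subseteq> face w' \<longleftrightarrow> (\<forall>i\<in>I. argmax w i \<subseteq> argmax w' i)"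
proof
  assume s: "face w \<subseteq> face w'"
  show "\<forall>i\<in>I. argmax w i \<subseteq> argmax w' i"
  proof (intro ballI subsetI)
    fix i j assume "i \<in> I" "j \<in> argmax w i"
    then obtain a where "a \<in> PiE I J" "a i = j" "point a \<in> face w"
      using exists_point_mem_face by blast
    then show "j \<in> argmax w' i" using s \<open>i \<in> I\<close> point_mem_face[of a w'] by blast
  qed
next
  assume s: "\<forall>i\<in>I. argmax w i \<subseteq> argmax w' i"
  \<comment> \<open>A face of a convex hull is the hull of some of the generators, so it suffices to
    compare selections.\<close>
  obtain X where X: "X \<subseteq> point ` PiE I J" "face w = convex hull X"
    using face_of_convex_hull_subset[OF finite_imp_compact[OF finite_points] face_face_of[unfolded sum_polytope_def]] .
  have "X \<subseteq> face w'"
  proof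
    fix x assume "x \<in> X"
    moreover from this have "x \<in> face w" unfolding X(2) by (rule hull_inc)
    ultimately obtain a where "x = point a" "a \<in> PiE I J" "point a \<in> face w" using X(1) by blast
    then show "x \<in> face w'" using s by (auto simp: point_mem_face)
  qed
  then show "face w \<subseteq> face w'"
    unfolding X(2) using face_face_of[of w'] by (intro hull_minimal) (auto dest: face_of_imp_convex simp: sum_polytope_def)
qed

end

section \<open>Simplices\<close>

text \<open>Translating one point to the origin leaves independent vectors, on which a linear
  functional can be prescribed. The constant \<open>t\<close> absorbs the translation; it will be
  harmless because slopes see only differences.\<close>

lemma exists_inner_affine_independent:
  fixes C :: "'a::euclidean_space set"
  assumes "\<not> affine_dependent C"
  obtains w t where "\<And>x. x \<in> C \<Longrightarrow> w \<bullet> x = f x + t"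
proof (cases "C = {}")
  case False
  then obtain a where a: "a \<in> C" by auto
  have "independent ((\<lambda>x. - a + x) ` (C - {a}))"
    using assms affine_dependent_iff_dependent2[OF a] by simp
  then obtain L :: "'a \<Rightarrow> real" where L: "linear L" "\<And>x. x \<in> C - {a} \<Longrightarrow> L (- a + x) = f x - f a"
    using linear_independent_extend[of "(\<lambda>x. - a + x) ` (C - {a})" "\<lambda>z. f (a + z) - f a"] by auto
  obtain w where w: "\<And>x. L x = w \<bullet> x"
  proof
    \<comment> \<open>The adjoint at \<open>1\<close> is the Riesz vector of
      \<open>L\<close>.\<close>
    show "L x = adjoint L 1 \<bullet> x" for x
      using adjoint_works[OF L(1), of x 1] by (simp add: inner_commute)
  qed
  have "w \<bullet> x = f x + (w \<bullet> a - f a)" if "x \<in> C" for x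
    using L(2)[of x] that by (cases "x = a") (auto simp: w inner_diff_right inner_add_right)
  then show ?thesis using that by blast
qed (use that in auto)

lemma exists_enumeration:
  fixes f :: "'a \<Rightarrow> real"
  assumes "finite C" "inj_on f C"
  obtains v where "bij_betw v {1..card C} C" "strict_mono_on {1..card C} (\<lambda>i. f (v i))"
proof -
  \<comment> \<open>The rank of \<open>x\<close> in the order of \<open>f\<close>-values; the
    enumeration is its inverse.\<close>
  define r where "r x = card {y \<in> C. f y \<le> f x}" for x
  have mono: "r x < r x'" if "x \<in> C" "x' \<in> C" "f x < f x'" for x x'
    unfolding r_def using that assms(1) by (intro psubset_card_mono) force+
  have inj: "inj_on r C"
    using mono assms(2) by (intro inj_onI) (metis inj_onD less_irrefl linorder_neqE_linordered_idom)
  have "r ` C \<subseteq> {1..card C}"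
  proof clarify
    fix x assume x: "x \<in> C"
    have "0 < r x" unfolding r_def using x assms(1) by (subst card_gt_0_iff) auto
    moreover have "r x \<le> card C" unfolding r_def using assms(1) by (intro card_mono) auto
    ultimately show "r x \<in> {1..card C}" by simp
  qed
  then have "r ` C = {1..card C}" using inj by (intro card_subset_eq) (auto simp: card_image)
  then have bij: "bij_betw r C {1..card C}" using inj by (simp add: bij_betw_def)
  define v where "v = inv_into C r"
  have v: "bij_betw v {1..card C} C" unfolding v_def by (rule bij_betw_inv_into[OF bij])
  have rv: "r (v i) = i" if "i \<in> {1..card C}" for i
    unfolding v_def using bij_betw_inv_into_right[OF bij that] .
  have "f (v i) < f (v j)" if "i \<in> {1..card C}" "j \<in> {1..card C}" "i < j" for i j
  proof (rule ccontr)
    assume n: "\<not> f (v i) < f (v j)"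
    have "v i \<in> C" "v j \<in> C" using v that by (auto simp: bij_betw_def)
    moreover have "f (v i) \<noteq> f (v j)"
      using \<open>v i \<in> C\<close> \<open>v j \<in> C\<close> assms(2) rv that by (metis inj_onD less_irrefl)
    ultimately have "r (v j) < r (v i)" using n by (intro mono) auto
    then show False using rv that by simp
  qed
  then show ?thesis using v that by (auto simp: strict_mono_on_def)
qed

text \<open>In a simplex every set of vertices spans a face, in particular every pair.\<close>

lemma adjacent_convex_hull_affine_independent:
  assumes "\<not> affine_dependent C" "u \<in> C" "v \<in> C" "u \<noteq> v"
  shows "adjacent (convex hull C) u v"
proof -
  have "closed_segment u v face_of convex hull C"
    using assms(2,3) unfolding face_of_convex_hull_affine_independent[OF assms(1)] segment_convex_hull
    by (intro exI[of _ "{u, v}"]) auto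
  then show ?thesis
    using assms(4) by (simp add: adjacent_def edge_of_def segment_convex_hull aff_dim_convex_hull aff_dim_2)
qed

section \<open>The pivot rule polytope of a simplex\<close>

theorem theorem4p3:
  fixes P :: "'a::euclidean_space set" and c :: 'a and n :: nat
  assumes "n \<ge> 2"
    and "(int n - 1) simplex P"
    and "edge_generic P c"
  shows "poset_isomorphic
           (nonempty_faces (max_slope_polytope P c)) (\<lambda>F G. F \<subseteq> G)
           (bracketings n) (\<lambda>B C. C \<subseteq> B)"
proof -
  obtain C where C: "\<not> affine_dependent C" "card C = n" "P = convex hull C"
    using assms(2) by (auto simp: simplex_def)
  have finC: "finite C" using C(1) aff_independent_finite by blast
  have verts: "polytope_vertices P = C"
    unfolding polytope_vertices_def C(3)
    by (simp add: extreme_point_of_convex_hull_affine_independent[OF C(1)])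
  have adj: "adjacent P x y" if "x \<in> C" "y \<in> C" "x \<noteq> y" for x y
    unfolding C(3) using that by (rule adjacent_convex_hull_affine_independent[OF C(1)])
  \<comment> \<open>All vertices are pairwise adjacent, so edge-genericity separates all of
    them.\<close>
  have "inj_on (\<lambda>x. c \<bullet> x) C"
    using adj assms(3) unfolding edge_generic_def by (meson inj_onI)
  with finC obtain v where v: "bij_betw v {1..n} C" and hm: "strict_mono_on {1..n} (\<lambda>i. c \<bullet> v i)"
    using exists_enumeration[of C "\<lambda>x. c \<bullet> x"] C(2) by blast
  define h where "h = (\<lambda>i. c \<bullet> v i)"
  have h: "strict_mono_on {1..n} h" using hm by (simp add: h_def)
  define u where "u = inv_into {1..n} v"
  have vC: "v i \<in> C" if "i \<in> {1..n}" for i using v that by (auto simp: bij_betw_def)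
  have uC: "u x \<in> {1..n}" "v (u x) = x" if "x \<in> C" for x
    using v that unfolding u_def by (auto simp: bij_betw_def inv_into_into f_inv_into_f)
  have uv: "u (v i) = i" if "i \<in> {1..n}" for i
    using v that unfolding u_def by (auto simp: bij_betw_def)

  have opt: "v_opt P c = v n"
    unfolding v_opt_def verts
  proof (rule the_equality)
    have "C \<subseteq> {x. c \<bullet> x \<le> c \<bullet> v n}"
    proof
      fix x assume "x \<in> C"
      then have "h (u x) \<le> h n" using uC[of x] assms(1) strict_mono_on_leD[OF h, of "u x" n] by auto
      then show "x \<in> {x. c \<bullet> x \<le> c \<bullet> v n}" using uC(2)[OF \<open>x \<in> C\<close>] by (simp add: h_def)
    qed
    then have top: "c \<bullet> x \<le> c \<bullet> v n" if "x \<in> P" for x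
      using hull_minimal[of C "{x. c \<bullet> x \<le> c \<bullet> v n}" convex] convex_halfspace_le[of c] that C(3) by blast
    then show "v n \<in> C \<and> (\<forall>x\<in>P. c \<bullet> x \<le> c \<bullet> v n)" using vC[of n] assms(1) by auto
    fix x assume x: "x \<in> C \<and> (\<forall>y\<in>P. c \<bullet> y \<le> c \<bullet> x)"
    have "v n \<in> P" unfolding C(3) using vC[of n] assms(1) by (intro hull_inc) auto
    then have "h n \<le> h (u x)" using x uC(2)[of x] by (simp add: h_def)
    then have "n \<le> u x" using strict_mono_onD[OF h, of "u x" n] uC(1)[of x] x
      by (meson atLeastAtMost_iff assms(1) le_trans not_le one_le_numeral order_refl)
    then have "u x = n" using uC(1)[of x] x by auto
    then show "x = v n" using uC(2)[of x] x by simp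
  qed
  have injv: "inj_on v {1..n}" and imv: "v ` {1..n} = C" using v by (simp_all add: bij_betw_def)
  have injv': "inj_on v {1..<n}" by (rule inj_on_subset[OF injv]) auto
  have nonopt: "C - {v n} = v ` {1..<n}"
  proof -
    have "v ` ({1..n} - {n}) = v ` {1..n} - v ` {n}"
      using assms(1) by (intro inj_on_image_set_diff[OF injv]) auto
    moreover have "{1..<n} = {1..n} - {n}" by auto
    ultimately show ?thesis using imv by simp
  qed

  \<comment> \<open>The contribution of vertex \<open>v i\<close> to \<open>arb_point\<close> when
    its successor is \<open>v j\<close>. Its inner product with \<open>w\<close> is the slope from
    \<open>i\<close> to \<open>j\<close> of the points
    \<open>(c \<bullet> v k, w \<bullet> v k)\<close>.\<close>
  define g where "g i j = (v j - v i) /\<^sub>R (h j - h i)" for i j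
  interpret S: selection_sum "{1..<n}" "\<lambda>i. {i<..n}" g by unfold_locales auto

  have arb_point: "arb_point P c A = S.point a" if "\<And>i. i \<in> {1..<n} \<Longrightarrow> A (v i) = v (a i)" for A a
    unfolding arb_point_def verts opt nonopt S.point_def sum.reindex[OF injv']
    using that by (intro sum.cong) (auto simp: g_def h_def inner_diff_right)
  have Q: "max_slope_polytope P c = S.sum_polytope"
  proof -
    \<comment> \<open>The improving neighbours of \<open>v i\<close> are exactly the
      \<open>v j\<close> with \<open>j > i\<close>, so passing between vertices and indices matches
      arborescences with selections.\<close>
    have "arb_point P c ` arborescences P c = S.point ` PiE {1..<n} (\<lambda>i. {i<..n})"
    proof (intro equalityI subsetI)
      fix x assume "x \<in> arb_point P c ` arborescences P c"
      then obtain A where A: "A \<in> arborescences P c" "x = arb_point P c A" by blast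
      have Av: "A (v i) \<in> C" "h i < c \<bullet> A (v i)" if "i \<in> {1..<n}" for i
        using A(1) that unfolding arborescences_def verts opt nonopt h_def by auto
      define a where "a = (\<lambda>i\<in>{1..<n}. u (A (v i)))"
      have "A (v i) = v (a i)" if "i \<in> {1..<n}" for i using uC(2)[OF Av(1)[OF that]] that by (simp add: a_def)
      then have "x = S.point a" using A(2) arb_point by blast
      moreover have "a i \<in> {i<..n}" if i: "i \<in> {1..<n}" for i
      proof -
        have "h i < h (u (A (v i)))" using Av[OF i] uC(2) by (simp add: h_def)
        then have "i < u (A (v i))"
          using strict_mono_on_less[OF h, of i "u (A (v i))"] uC(1)[OF Av(1)[OF i]] i by auto
        then show ?thesis using uC(1)[OF Av(1)[OF i]] i by (simp add: a_def)
      qed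
      then have "a \<in> PiE {1..<n} (\<lambda>i. {i<..n})" by (auto simp: a_def)
      ultimately show "x \<in> S.point ` PiE {1..<n} (\<lambda>i. {i<..n})" by blast
    next
      fix x assume "x \<in> S.point ` PiE {1..<n} (\<lambda>i. {i<..n})"
      then obtain a where a: "a \<in> PiE {1..<n} (\<lambda>i. {i<..n})" "x = S.point a" by blast
      define A where "A = (\<lambda>x\<in>v ` {1..<n}. v (a (u x)))"
      have Av: "A (v i) = v (a i)" if "i \<in> {1..<n}" for i using uv[of i] that by (auto simp: A_def)
      have ai: "a i \<in> {i<..n}" if "i \<in> {1..<n}" for i using a(1) that by (rule PiE_mem)
      have "A (v i) \<in> C \<and> adjacent P (v i) (A (v i)) \<and> c \<bullet> v i < c \<bullet> A (v i)" if i: "i \<in> {1..<n}" for i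
      proof -
        have lt: "h i < h (a i)" using ai[OF i] i by (intro strict_mono_onD[OF h]) auto
        then have "v i \<noteq> v (a i)" by (auto simp: h_def)
        moreover have mem: "v i \<in> C" "v (a i) \<in> C" using ai[OF i] i by (auto intro!: vC)
        ultimately have "adjacent P (v i) (v (a i))" using adj by blast
        then show ?thesis using lt mem Av[OF i] by (simp add: h_def)
      qed
      moreover have "A \<in> extensional (v ` {1..<n})" unfolding A_def by simp
      ultimately have "A \<in> arborescences P c"
        unfolding arborescences_def verts opt nonopt by (auto simp: PiE_def)
      moreover have "x = arb_point P c A" using arb_point[of A a] Av a(2) by simp
      ultimately show "x \<in> arb_point P c ` arborescences P c" by blast
    qed
    then show ?thesis unfolding max_slope_polytope_def S.sum_polytope_def by (rule arg_cong)
  qed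

  define m where "m w = max_slope n h (\<lambda>i. w \<bullet> v i)" for w
  have inner_g: "w \<bullet> g i j = slope h (\<lambda>i. w \<bullet> v i) i j" for w i j
    by (simp add: g_def slope_def inner_diff_right divide_inverse mult.commute)
  have argmax: "S.argmax w i = reach n (m w) i" if "i \<in> {1..<n}" for w i
    using argmax_slope_eq_reach[OF h that, of "\<lambda>i. w \<bullet> v i"]
    unfolding S.argmax_def S.best_def inner_g max_slope_def m_def .

  have "bracketings n \<subseteq> range (\<lambda>w. level_brackets n (m w))"
  proof
    fix B assume B: "B \<in> bracketings n"
    obtain y where y: "\<And>i. i \<in> {1..<n} \<Longrightarrow> max_slope n h y i = depth B i"
      using exists_max_slope[OF h, of "depth B"] by blast
    \<comment> \<open>On the vertices of a simplex the heights \<open>y\<close> extend to a linear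
      functional up to a shift \<open>t\<close>, which cancels in every slope.\<close>
    obtain w t where w: "\<And>x. x \<in> C \<Longrightarrow> w \<bullet> x = y (u x) + t"
      using exists_inner_affine_independent[OF C(1), of "\<lambda>x. y (u x)"] by blast
    have wv: "w \<bullet> v i = y i + t" if "i \<in> {1..n}" for i using w[OF vC[OF that]] uv[OF that] by simp
    have "m w i = depth B i" if i: "i \<in> {1..<n}" for i
    proof -
      have "slope h (\<lambda>i. w \<bullet> v i) i ` {i<..n} = slope h y i ` {i<..n}"
        using i by (intro image_cong) (auto simp: slope_def wv)
      then show ?thesis using y[OF i] by (simp add: m_def max_slope_def)
    qed
    then have "B = level_brackets n (m w)"
      using level_brackets_cong[of n "m w" "depth B"] level_brackets_depth[OF B] by simp
    then show "B \<in> range (\<lambda>w. level_brackets n (m w))" by blast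
  qed
  then have "bracketings n = range (\<lambda>w. level_brackets n (m w))"
    using level_brackets_bracketing[OF assms(1)] by blast
  moreover have "S.face w \<subseteq> S.face w' \<longleftrightarrow> level_brackets n (m w') \<subseteq> level_brackets n (m w)" for w w'
    unfolding S.face_subset_iff level_brackets_subset_iff using argmax by simp
  ultimately show ?thesis
    unfolding Q by (intro poset_isomorphic_range[OF S.nonempty_faces_eq])
qed

end
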